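(* Let $d\ge1$. Every $d$-regular graph $G$ with $n$ vertices contains a spanning subgraph $H$ satisfying $m(H)\le 8\frac{n}{d}+2$.
   Context: All graphs are finite and simple. For a graph $G$ and an integer $k\ge 0$, $m(G,k)$ denotes the number of vertices of degree exactly $k$ in $G$, and $m(G)=\max_k m(G,k)$. A spanning subgraph of $G$ is a subgraph with the same vertex set as $G$. *)

theory Defs
  imports Complex_Main
begin

definition simple_graph :: "'a set \<Rightarrow> 'a set set \<Rightarrow> bool" where
  "simple_graph V E \<longleftrightarrow> finite V \<and> (\<forall>e\<in>E. e \<subseteq> V \<and> card e = 2)"

definition degree :: "'a set set \<Rightarrow> 'a \<Rightarrow> nat" where
  "degree E v = card {e \<in> E. v \<in> e}"

definition regular :: "'a set \<Rightarrow> 'a set set \<Rightarrow> nat \<Rightarrow> bool" where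
  "regular V E d \<longleftrightarrow> (\<forall>v\<in>V. degree E v = d)"

definition mult_deg :: "'a set \<Rightarrow> 'a set set \<Rightarrow> nat \<Rightarrow> nat" where
  "mult_deg V E k = card {v \<in> V. degree E v = k}"

text \<open>m(G) = max_k m(G,k). The range is finite since each value is at most card V.\<close>
definition max_mult :: "'a set \<Rightarrow> 'a set set \<Rightarrow> nat" where
  "max_mult V E = Max ((\<lambda>k. mult_deg V E k) ` UNIV)"

definition spanning_subgraph :: "'a set \<Rightarrow> 'a set set \<Rightarrow> 'a set set \<Rightarrow> bool" where
  "spanning_subgraph V E F \<longleftrightarrow> F \<subseteq> E"

end

theory Submission
  imports Defs
begin

text \<open>
  The theorem follows from a degree-constrained subgraph theorem of Addario-Berry, Dalal and Reed:
  under mild conditions on \<open>l\<close> and \<open>u\<close> there is a spanning subgraph in which every vertex \<open>v\<close> has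
  degree \<open>l v\<close>, \<open>l v + 1\<close>, \<open>u v\<close> or \<open>u v + 1\<close>. For a \<open>d\<close>-regular graph one can find
  \<open>\<lceil>d/8\<rceil>\<close> pairs \<open>(l, u)\<close> whose sets \<open>{l, l + 1, u, u + 1}\<close> are pairwise disjoint, and distributes
  them evenly among the vertices.

  For the degree-constrained subgraph, choose a target \<open>a v \<in> {l v, u v}\<close> for every vertex and a
  subgraph \<open>H\<close> with all degrees at most \<open>a v + 1\<close> such that the total deficit below the targets is
  least. If some \<open>r\<close> is deficient, let \<open>A\<close> and \<open>B\<close> be the sets of vertices that alternating paths from
  \<open>r\<close> (starting outside \<open>H\<close>) reach after an even and an odd number of steps. By minimality every edge
  outside \<open>H\<close> at \<open>A\<close> leads to \<open>B\<close>, every edge of \<open>H\<close> at \<open>B\<close> leads to \<open>A\<close>, and, since the targets cannot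
  be switched profitably either, \<open>H\<close> contains at least half of the \<open>A\<close>-\<open>B\<close> edges at each vertex of
  \<open>B\<close>, but at most half, and at \<open>r\<close> less than half, of those at each vertex of \<open>A\<close>. Counting the
  \<open>A\<close>-\<open>B\<close> edges from both sides gives a contradiction.
\<close>

section \<open>Degrees\<close>

lemma degree_mono: "finite F \<Longrightarrow> G \<subseteq> F \<Longrightarrow> degree G x \<le> degree F x"
  unfolding degree_def by (rule card_mono) auto

lemma degree_eq_0: "(\<And>e. e \<in> F \<Longrightarrow> x \<notin> e) \<Longrightarrow> degree F x = 0"
  unfolding degree_def by (simp add: card_eq_0_iff)

lemma degree_Un_disjoint:
  assumes "finite F" "finite G" "F \<inter> G = {}"
  shows "degree (F \<union> G) x = degree F x + degree G x"
proof -
  have "{e \<in> F \<union> G. x \<in> e} = {e \<in> F. x \<in> e} \<union> {e \<in> G. x \<in> e}" by auto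
  then show ?thesis
    unfolding degree_def using assms by (simp add: card_Un_disjoint disjoint_iff)
qed

lemma degree_Diff:
  assumes "finite F" "G \<subseteq> F"
  shows "degree (F - G) x + degree G x = degree F x"
proof -
  have "(F - G) \<union> G = F" "(F - G) \<inter> G = {}" "finite G"
    using assms finite_subset by auto
  then show ?thesis
    using degree_Un_disjoint[of "F - G" G x] assms(1) by simp
qed

lemma degree_insert:
  assumes "finite F" "e \<notin> F"
  shows "degree (insert e F) x = degree F x + of_bool (x \<in> e)"
proof -
  have "degree {e} x = of_bool (x \<in> e)"
    unfolding degree_def by (simp add: Collect_conv_if)
  then show ?thesis
    using degree_Un_disjoint[of F "{e}" x] assms by simp
qed

lemma degree_remove:
  assumes "finite F" "e \<in> F"
  shows "degree (F - {e}) x + of_bool (x \<in> e) = degree F x"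
  using degree_insert[of "F - {e}" e x] assms by (simp add: insert_absorb)

lemma degree_star_centre: "(\<And>e. e \<in> X \<Longrightarrow> v \<in> e) \<Longrightarrow> degree X v = card X"
  unfolding degree_def by (rule arg_cong[where f = card]) auto

lemma degree_star_leaf:
  assumes "\<And>e. e \<in> X \<Longrightarrow> v \<in> e \<and> card e = 2" "x \<noteq> v"
  shows "degree X x \<le> 1"
proof -
  have "{e \<in> X. x \<in> e} \<subseteq> {{v, x}}"
    using assms by (auto simp: card_2_iff)
  from card_mono[OF _ this] show ?thesis
    unfolding degree_def by simp
qed

lemma sum_degree_eq_card:
  assumes "finite M" "finite A" "\<And>e. e \<in> M \<Longrightarrow> card (e \<inter> A) = 1"
  shows "(\<Sum>v\<in>A. degree M v) = card M"
proof -
  have "(\<Sum>v\<in>A. degree M v) = (\<Sum>v\<in>A. \<Sum>e\<in>M. of_bool (v \<in> e))"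
    unfolding degree_def using assms(1) by (simp add: Int_def)
  also have "\<dots> = (\<Sum>e\<in>M. \<Sum>v\<in>A. of_bool (v \<in> e))"
    by (rule sum.swap)
  also have "\<dots> = (\<Sum>e\<in>M. card (e \<inter> A))"
    using assms(2) by (simp add: Int_def conj_commute)
  finally show ?thesis using assms(3) by simp
qed

section \<open>Subgraphs of least deficit\<close>

text \<open>\<open>l_le\<close> and \<open>u_ge\<close> determine the current target of a vertex
  that violates \<open>degree_M_A\<close> or \<open>degree_M_B\<close>; \<open>u_le_degree\<close>
  and \<open>u_le_l\<close> then supply enough edges to switch it. Truncated subtraction ignores
  surpluses.\<close>

locale least_deficit =
  fixes V :: "'a set" and E H :: "'a set set" and l u a :: "'a \<Rightarrow> nat" and r :: 'a
  assumes graph: "simple_graph V E"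
    and l_le: "\<And>v. v \<in> V \<Longrightarrow> 2 * l v \<le> degree E v"
    and u_ge: "\<And>v. v \<in> V \<Longrightarrow> degree E v \<le> 2 * u v + 2"
    and u_le_degree: "\<And>v. v \<in> V \<Longrightarrow> 2 * u v \<le> degree E v + l v + 2"
    and u_le_l: "\<And>v. v \<in> V \<Longrightarrow> u v \<le> 2 * l v + 3"
    and H_sub: "H \<subseteq> E"
    and target: "\<And>v. v \<in> V \<Longrightarrow> a v \<in> {l v, u v}"
    and cap: "\<And>v. v \<in> V \<Longrightarrow> degree H v \<le> a v + 1"
    and least: "\<And>F b. F \<subseteq> E \<Longrightarrow> (\<And>v. v \<in> V \<Longrightarrow> b v \<in> {l v, u v}) \<Longrightarrow>
      (\<And>v. v \<in> V \<Longrightarrow> degree F v \<le> b v + 1) \<Longrightarrow>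
      (\<Sum>v\<in>V. a v - degree H v) \<le> (\<Sum>v\<in>V. b v - degree F v)"
    and root: "r \<in> V" "degree H r < a r"
begin

lemma finite_V: "finite V"
  using graph unfolding simple_graph_def by simp

lemma edge: "e \<in> E \<Longrightarrow> e \<subseteq> V \<and> card e = 2"
  using graph unfolding simple_graph_def by auto

lemma edge_at: "e \<in> E \<Longrightarrow> v \<in> e \<Longrightarrow> \<exists>w. e = {v, w}"
  using edge[of e] by (metis card_2_iff insert_commute insertE singletonD)

lemma finite_E: "finite E"
  using finite_V edge by (meson Pow_iff finite_Pow_iff finite_subset subsetI)

lemma finite_sub: "F \<subseteq> E \<Longrightarrow> finite F"
  using finite_E by (rule rev_finite_subset)

lemma no_improvement:
  assumes "F \<subseteq> E" "\<And>v. v \<in> V \<Longrightarrow> b v \<in> {l v, u v}"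
    and "\<And>v. v \<in> V \<Longrightarrow> degree F v \<le> b v + 1"
    and "\<And>v. v \<in> V \<Longrightarrow> b v - degree F v \<le> a v - degree H v"
    and "y \<in> V" "b y - degree F y < a y - degree H y"
  shows False
proof -
  have "(\<Sum>v\<in>V. b v - degree F v) < (\<Sum>v\<in>V. a v - degree H v)"
    by (rule sum_strict_mono_ex1) (use assms finite_V in auto)
  then show False using least[of F b] assms(1-3) by fastforce
qed

text \<open>A low vertex can gain an edge within its cap; any other vertex of \<open>V\<close> can
  lose one without becoming deficient.\<close>

definition low :: "'a \<Rightarrow> bool" where
  "low v \<longleftrightarrow> degree H v \<le> a v"

lemma high_degree: "v \<in> V \<Longrightarrow> \<not> low v \<Longrightarrow> degree H v = a v + 1"
  using cap[of v] unfolding low_def by simp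

lemma low_root: "low r"
  using root unfolding low_def by simp

section \<open>Alternating paths from the deficient vertex\<close>

text \<open>\<open>alt v S F\<close>: some alternating path from \<open>r\<close> to \<open>v\<close> has vertex set \<open>S\<close>, and exchanging its edges
  turns \<open>H\<close> into \<open>F\<close>. The degree test decides the parity of a vertex on the path in advance; that
  no reachable vertex is missed this way is the content of \<open>reached_low_closed\<close> and
  \<open>reached_high_closed\<close>.\<close>

inductive alt :: "'a \<Rightarrow> 'a set \<Rightarrow> 'a set set \<Rightarrow> bool" where
  start: "alt r {r} H"
| up: "alt v S F \<Longrightarrow> low v \<Longrightarrow> \<not> low w \<Longrightarrow> {v, w} \<in> E - H \<Longrightarrow> w \<notin> S \<Longrightarrow>
    alt w (insert w S) (insert {v, w} F)"
| down: "alt v S F \<Longrightarrow> \<not> low v \<Longrightarrow> low w \<Longrightarrow> {v, w} \<in> H \<Longrightarrow> w \<notin> S \<Longrightarrow>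
    alt w (insert w S) (F - {{v, w}})"

lemma alt_sub: "alt v S F \<Longrightarrow> F \<subseteq> E"
  by (induction rule: alt.induct) (use H_sub in auto)

lemma alt_in_V: "alt v S F \<Longrightarrow> v \<in> V"
  by (induction rule: alt.induct) (use H_sub edge root in blast)+

lemma alt_mem: "alt v S F \<Longrightarrow> v \<in> S"
  by (induction rule: alt.induct) auto

text \<open>Every exchanged edge joins a low vertex to one that is not low.\<close>

lemma alt_agree_same_level:
  "alt v S F \<Longrightarrow> low x = low y \<Longrightarrow> {x, y} \<in> F \<longleftrightarrow> {x, y} \<in> H"
  by (induction rule: alt.induct) (auto simp: doubleton_eq_iff)

lemma alt_agree_outside:
  "alt v S F \<Longrightarrow> x \<notin> S \<Longrightarrow> {y, x} \<in> F \<longleftrightarrow> {y, x} \<in> H"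
proof (induction rule: alt.induct)
  case (up v S F w)
  with alt_mem[OF up.hyps(1)] show ?case by (auto simp: doubleton_eq_iff)
next
  case (down v S F w)
  with alt_mem[OF down.hyps(1)] show ?case by (auto simp: doubleton_eq_iff)
qed simp

text \<open>Additive form, so that no subtraction occurs and \<open>v = r\<close> needs no exception.\<close>

lemma alt_degree:
  assumes "alt v S F"
  shows "degree F x + of_bool (x = v \<and> low v) =
    degree H x + of_bool (x = r) + of_bool (x = v \<and> \<not> low v)"
  using assms
proof (induction rule: alt.induct)
  case start
  then show ?case using low_root by simp
next
  case (up v S F w)
  have "{v, w} \<notin> F"
    using alt_agree_outside[OF up.hyps(1) up.hyps(5), of v] up.hyps by simp
  from degree_insert[OF finite_sub[OF alt_sub[OF up.hyps(1)]] this, of x] up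
  show ?case by (auto split: if_splits simp: of_bool_def)
next
  case (down v S F w)
  have "{v, w} \<in> F"
    using alt_agree_outside[OF down.hyps(1) down.hyps(5), of v] down.hyps by simp
  from degree_remove[OF finite_sub[OF alt_sub[OF down.hyps(1)]] this, of x] down
  show ?case by (auto split: if_splits simp: of_bool_def)
qed

definition reached :: "'a set" where
  "reached = {v. \<exists>S F. alt v S F}"

lemma alt_subset_reached: "alt v S F \<Longrightarrow> S \<subseteq> reached"
proof (induction rule: alt.induct)
  case start
  show ?case unfolding reached_def using alt.start by blast
next
  case (up v S F w)
  from alt.up[OF up.hyps] up.IH show ?case unfolding reached_def by blast
next
  case (down v S F w)
  from alt.down[OF down.hyps] down.IH show ?case unfolding reached_def by blast
qed

lemma reached_sub: "reached \<subseteq> V"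
  unfolding reached_def using alt_in_V by auto

lemma root_reached: "r \<in> reached"
  unfolding reached_def using alt.start by blast

text \<open>If \<open>w\<close> were low, exchanging along the path and adding \<open>{v, w}\<close>
  would help \<open>r\<close> and break no cap.\<close>

lemma reached_low_closed:
  assumes "v \<in> reached" "low v" "{v, w} \<in> E - H"
  shows "w \<in> reached \<and> \<not> low w"
proof -
  obtain S F where alt: "alt v S F" using assms(1) unfolding reached_def by blast
  have vw: "v \<noteq> w" "w \<in> V" using edge[of "{v, w}"] assms(3) by auto
  have high: "\<not> low w"
  proof
    assume "low w"
    then have new: "{v, w} \<notin> F"
      using alt_agree_same_level[OF alt, of v w] assms by simp
    have deg: "degree (insert {v, w} F) x = degree H x + of_bool (x = r) + of_bool (x = w)" for x
      using degree_insert[OF finite_sub[OF alt_sub[OF alt]] new, of x] alt_degree[OF alt, of x]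
        assms(2) vw by (auto simp: of_bool_def split: if_splits)
    show False
    proof (rule no_improvement[where F = "insert {v, w} F" and b = a and y = r])
      \<comment> \<open>If \<open>w = r\<close>, the root gains two edges, but it started below
        \<open>a r\<close>.\<close>
      show "degree (insert {v, w} F) x \<le> a x + 1" if "x \<in> V" for x
        using deg[of x] cap[OF that] root \<open>low w\<close>
        unfolding low_def by (auto simp: of_bool_def split: if_splits)
    qed (use alt_sub[OF alt] assms(3) target root deg in auto)
  qed
  moreover have "w \<in> reached"
  proof (cases "w \<in> S")
    case True
    with alt_subset_reached[OF alt] show ?thesis by auto
  next
    case False
    from alt.up[OF alt assms(2) high assms(3) False] show ?thesis
      unfolding reached_def by blast
  qed
  ultimately show ?thesis by simp
qed

text \<open>Otherwise deleting \<open>{v, w}\<close> after the exchange would only lower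
  \<open>w\<close> from \<open>a w + 1\<close> to \<open>a w\<close>, while \<open>r\<close> gains
  an edge.\<close>

lemma reached_high_closed:
  assumes "v \<in> reached" "\<not> low v" "{v, w} \<in> H"
  shows "w \<in> reached \<and> low w"
proof -
  obtain S F where alt: "alt v S F" using assms(1) unfolding reached_def by blast
  have vw: "v \<noteq> w" "w \<in> V" using edge[of "{v, w}"] assms(3) H_sub by auto
  have low: "low w"
  proof (rule ccontr)
    assume "\<not> low w"
    then have old: "{v, w} \<in> F"
      using alt_agree_same_level[OF alt, of v w] assms by simp
    have deg: "degree (F - {{v, w}}) x + of_bool (x = w) = degree H x + of_bool (x = r)" for x
      using degree_remove[OF finite_sub[OF alt_sub[OF alt]] old, of x] alt_degree[OF alt, of x]
        assms(2) vw by (auto simp: of_bool_def split: if_splits)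
    have "w \<noteq> r" using low_root \<open>\<not> low w\<close> by auto
    show False
    proof (rule no_improvement[where F = "F - {{v, w}}" and b = a and y = r])
      show "degree (F - {{v, w}}) x \<le> a x + 1" if "x \<in> V" for x
        using deg[of x] cap[OF that] root by (auto simp: of_bool_def split: if_splits)
      show "a x - degree (F - {{v, w}}) x \<le> a x - degree H x" if "x \<in> V" for x
        using deg[of x] high_degree[OF vw(2) \<open>\<not> low w\<close>]
        by (auto simp: of_bool_def split: if_splits)
      show "a r - degree (F - {{v, w}}) r < a r - degree H r"
        using deg[of r] \<open>w \<noteq> r\<close> root by simp
    qed (use alt_sub[OF alt] target root in auto)
  qed
  moreover have "w \<in> reached"
  proof (cases "w \<in> S")
    case True
    with alt_subset_reached[OF alt] show ?thesis by auto
  next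
    case False
    from alt.down[OF alt assms(2) low assms(3) False] show ?thesis
      unfolding reached_def by blast
  qed
  ultimately show ?thesis by simp
qed

section \<open>The bipartite graph between \<open>A\<close> and \<open>B\<close>\<close>

definition A :: "'a set" where "A = {v \<in> reached. low v}"

definition B :: "'a set" where "B = {v \<in> reached. \<not> low v}"

definition M :: "'a set set" where "M = {e \<in> E. e \<inter> A \<noteq> {} \<and> e \<inter> B \<noteq> {}}"

lemma A_B: "A \<subseteq> V" "B \<subseteq> V" "A \<inter> B = {}" "r \<in> A"
  using reached_sub root_reached low_root unfolding A_def B_def by auto

lemma finite_M: "finite M"
  using finite_E unfolding M_def by simp

lemma M_edge:
  assumes "e \<in> M"
  obtains x y where "x \<in> A" "y \<in> B" "e = {x, y}"
proof -
  obtain x y where xy: "x \<in> e" "x \<in> A" "y \<in> e" "y \<in> B" and "e \<in> E"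
    using assms unfolding M_def by auto
  moreover have "x \<noteq> y" using xy A_B by auto
  ultimately have "e = {x, y}" using edge_at[of e x] by auto
  with that xy show thesis by blast
qed

lemma degree_M_le: "degree M v \<le> degree E v"
  by (rule degree_mono[OF finite_E]) (auto simp: M_def)

lemma degree_A:
  assumes "v \<in> A"
  shows "degree (M - H) v + degree H v = degree E v"
proof -
  have "e \<in> M" if "e \<in> E - H" "v \<in> e" for e
  proof -
    obtain w where "e = {v, w}"
      using edge_at[of e v] \<open>v \<in> e\<close> \<open>e \<in> E - H\<close> by auto
    with reached_low_closed[of v w] that assms show ?thesis
      unfolding A_def B_def M_def by auto
  qed
  then have "{e \<in> M - H. v \<in> e} = {e \<in> E - H. v \<in> e}"
    unfolding M_def by auto
  then have "degree (M - H) v = degree (E - H) v" unfolding degree_def by simp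
  with degree_Diff[OF finite_E H_sub, of v] show ?thesis by simp
qed

lemma degree_B:
  assumes "v \<in> B"
  shows "degree (M \<inter> H) v = degree H v"
proof -
  have "e \<in> M" if "e \<in> H" "v \<in> e" for e
  proof -
    obtain w where "e = {v, w}"
      using edge_at[of e v] \<open>v \<in> e\<close> \<open>e \<in> H\<close> H_sub by auto
    with reached_high_closed[of v w] that assms H_sub show ?thesis
      unfolding A_def B_def M_def by auto
  qed
  then have "{e \<in> M \<inter> H. v \<in> e} = {e \<in> H. v \<in> e}" by auto
  then show ?thesis unfolding degree_def by simp
qed

text \<open>If the inequality fails, \<open>v\<close> can be moved from target \<open>l v\<close> to target \<open>u v\<close> by adding edges to
  \<open>A\<close>, all of whose vertices tolerate one more edge.\<close>

lemma degree_M_B: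
  assumes "v \<in> B"
  shows "degree M v \<le> 2 * degree H v"
proof (rule ccontr)
  assume neg: "\<not> ?thesis"
  have v: "v \<in> V" "\<not> low v" "v \<noteq> r" using assms A_B unfolding B_def A_def by auto
  note dv = high_degree[OF v(1,2)]
  have "a v \<noteq> u v"
    using neg dv u_ge[OF v(1)] degree_M_le[of v] by auto
  then have av: "a v = l v" using target[OF v(1)] by simp
  have lu: "l v < u v"
    using neg dv av u_ge[OF v(1)] degree_M_le[of v] by auto
  obtain S F where alt: "alt v S F" using assms unfolding B_def reached_def by blast
  note F_sub = alt_sub[OF alt] and finF = finite_sub[OF alt_sub[OF alt]]
  have Fv: "degree F v = l v + 2" using alt_degree[OF alt, of v] v dv av by simp
  have "degree M v \<le> degree (M - F) v + degree F v"
  proof -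
    have "degree M v \<le> degree ((M - F) \<union> F) v"
      by (rule degree_mono) (use finite_M finF in auto)
    also have "\<dots> = degree (M - F) v + degree F v"
      by (rule degree_Un_disjoint) (use finite_M finF in auto)
    finally show ?thesis .
  qed
  \<comment> \<open>These edges raise \<open>v\<close> from \<open>l v + 2\<close> to
    \<open>u v\<close>. If \<open>u v = l v + 1\<close>, the difference truncates to 0 and
    \<open>v\<close> has degree \<open>u v + 1\<close>, still within the new cap.\<close>
  then have "u v - l v - 2 \<le> card {e \<in> M - F. v \<in> e}"
    using neg dv av Fv u_le_l[OF v(1)] unfolding degree_def by simp
  then obtain X where X: "X \<subseteq> {e \<in> M - F. v \<in> e}" "card X = u v - l v - 2" "finite X"
    by (meson obtain_subset_with_card_n)
  have XE: "X \<subseteq> E" using X unfolding M_def by auto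
  have star: "\<And>e. e \<in> X \<Longrightarrow> v \<in> e \<and> card e = 2" using X XE edge by blast
  have deg: "degree (F \<union> X) x = degree F x + degree X x" for x
    using degree_Un_disjoint[of F X x] finF X by auto
  have X0: "degree X x = 0" if "x \<notin> A" "x \<noteq> v" for x
  proof -
    have "x \<notin> e" if "e \<in> X" for e
    proof -
      have "e \<in> M" using X that by auto
      then obtain y z where "y \<in> A" "z \<in> B" "e = {y, z}" by (rule M_edge)
      with star[OF that] \<open>x \<notin> A\<close> \<open>x \<noteq> v\<close> A_B assms show ?thesis by auto
    qed
    then show ?thesis by (rule degree_eq_0)
  qed
  have Xv: "degree X v = u v - l v - 2"
    using degree_star_centre[of X v] star X(2) by simp
  have X1: "degree X x \<le> 1" if "x \<noteq> v" for x
    using degree_star_leaf[OF star that] .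
  have Fx: "degree F x = degree H x + of_bool (x = r)" if "x \<noteq> v" for x
    using alt_degree[OF alt, of x] that by simp
  show False
  proof (rule no_improvement[where F = "F \<union> X" and b = "a(v := u v)" and y = r])
    show "degree (F \<union> X) x \<le> (a(v := u v)) x + 1" if "x \<in> V" for x
    proof (cases "x = v")
      case True
      then show ?thesis using deg[of v] Fv Xv lu by simp
    next
      case False
      show ?thesis
      proof (cases "x \<in> A")
        case True
        with deg[of x] Fx[OF False] X1[OF False] False root show ?thesis
          unfolding A_def low_def by (auto simp: of_bool_def split: if_splits)
      next
        case False': False
        then have "x \<noteq> r" using A_B by auto
        with deg[of x] Fx[OF False] X0[OF False' False] False cap[OF that] show ?thesis
          by simp
      qed
    qed
    show "(a(v := u v)) x - degree (F \<union> X) x \<le> a x - degree H x" for x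
    proof (cases "x = v")
      case True
      then show ?thesis using deg[of v] Fv Xv lu by simp
    next
      case False
      then show ?thesis using deg[of x] Fx[OF False] by simp
    qed
    show "(a(v := u v)) r - degree (F \<union> X) r < a r - degree H r"
      using deg[of r] Fx[of r] v root by auto
  qed (use F_sub XE target root v in auto)
qed

text \<open>If the inequality fails, \<open>v\<close> can be moved from target \<open>u v\<close> to target \<open>l v\<close> by deleting edges to
  \<open>B\<close>, all of whose vertices tolerate the loss of one edge.\<close>

lemma degree_M_A:
  assumes "v \<in> A"
  shows "degree M v + 2 * a v \<le> 2 * degree E v"
proof (rule ccontr)
  assume neg: "\<not> ?thesis"
  have v: "v \<in> V" "low v" using assms A_B unfolding A_def by auto
  have "a v \<noteq> l v"
    using neg l_le[OF v(1)] degree_M_le[of v] by auto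
  then have av: "a v = u v" using target[OF v(1)] by simp
  have lu: "l v < u v"
    using neg av l_le[OF v(1)] degree_M_le[of v] by auto
  obtain S F where alt: "alt v S F" using assms unfolding A_def reached_def by blast
  note F_sub = alt_sub[OF alt] and finF = finite_sub[OF alt_sub[OF alt]]
  have Fv: "degree F v + 1 = degree H v + of_bool (v = r)"
    using alt_degree[OF alt, of v] v by simp
  have "degree F v + degree M v \<le> degree (F \<inter> M) v + degree E v"
  proof -
    have "degree F v = degree (F - M) v + degree (F \<inter> M) v"
      using degree_Diff[OF finF, of "F \<inter> M" v] by (simp add: Diff_Int)
    moreover have "degree (F - M) v \<le> degree (E - M) v"
      by (rule degree_mono) (use finite_E F_sub in auto)
    moreover have "degree (E - M) v + degree M v = degree E v"
      by (rule degree_Diff[OF finite_E]) (auto simp: M_def)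
    ultimately show ?thesis by simp
  qed
  \<comment> \<open>Deleting this many edges brings \<open>v\<close> down to \<open>l v + 1\<close>,
    the cap of its new target.\<close>
  then have "degree F v - (l v + 1) \<le> card {e \<in> F \<inter> M. v \<in> e}"
    using neg av u_le_degree[OF v(1)] unfolding degree_def by simp
  then obtain X where X: "X \<subseteq> {e \<in> F \<inter> M. v \<in> e}" "card X = degree F v - (l v + 1)" "finite X"
    by (meson obtain_subset_with_card_n)
  have XF: "X \<subseteq> F" using X by auto
  have star: "\<And>e. e \<in> X \<Longrightarrow> v \<in> e \<and> card e = 2" using X F_sub edge by blast
  have deg: "degree (F - X) x + degree X x = degree F x" for x
    using degree_Diff[OF finF XF, of x] .
  have X0: "degree X x = 0" if "x \<notin> B" "x \<noteq> v" for x
  proof -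
    have "x \<notin> e" if "e \<in> X" for e
    proof -
      have "e \<in> M" using X that by auto
      then obtain y z where "y \<in> A" "z \<in> B" "e = {y, z}" by (rule M_edge)
      with star[OF that] \<open>x \<notin> B\<close> \<open>x \<noteq> v\<close> A_B assms show ?thesis by auto
    qed
    then show ?thesis by (rule degree_eq_0)
  qed
  have Xv: "degree X v = degree F v - (l v + 1)"
    using degree_star_centre[of X v] star X(2) by simp
  have X1: "degree X x \<le> 1" if "x \<noteq> v" for x
    using degree_star_leaf[OF star that] .
  have Fx: "degree F x = degree H x + of_bool (x = r)" if "x \<noteq> v" for x
    using alt_degree[OF alt, of x] that by simp
  show False
  proof (rule no_improvement[where F = "F - X" and b = "a(v := l v)" and y = r])
    show "degree (F - X) x \<le> (a(v := l v)) x + 1" if "x \<in> V" for x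
    proof (cases "x = v")
      case True
      then show ?thesis using deg[of v] Xv by simp
    next
      case False
      then show ?thesis
        using deg[of x] Fx[OF False] cap[OF that] root by (auto simp: of_bool_def split: if_splits)
    qed
    show "(a(v := l v)) x - degree (F - X) x \<le> a x - degree H x" if "x \<in> V" for x
    proof (cases "x = v")
      case True
      then show ?thesis
        using deg[of v] Fv Xv lu av by (auto simp: of_bool_def split: if_splits)
    next
      case False
      show ?thesis
      proof (cases "x \<in> B")
        case True
        then have "degree H x = a x + 1" using high_degree[OF that] unfolding B_def by simp
        with deg[of x] Fx[OF False] X1[OF False] False show ?thesis by simp
      next
        case False': False
        with deg[of x] Fx[OF False] X0[OF False' False] False show ?thesis by simp
      qed
    qed
    show "(a(v := l v)) r - degree (F - X) r < a r - degree H r"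
    proof (cases "r = v")
      \<comment> \<open>Here \<open>F\<close> and \<open>H\<close> have the same degree at
        \<open>r\<close>; the deficit falls because the target drops from \<open>u v\<close> to
        \<open>l v\<close>.\<close>
      case True
      then show ?thesis using deg[of v] Fv Xv lu av root by simp
    next
      case False
      then have "degree X r = 0" using X0 A_B by blast
      then show ?thesis using deg[of r] Fx[OF False] False root by simp
    qed
  qed (use F_sub target root v in auto)
qed

section \<open>Double counting\<close>

lemma contradiction: False
proof -
  have fin: "finite A" "finite B" using A_B finite_subset[OF _ finite_V] by blast+
  have one: "card (e \<inter> A) = 1" "card (e \<inter> B) = 1" if e: "e \<in> M" for e
  proof -
    obtain x y where "x \<in> A" "y \<in> B" "e = {x, y}" using e by (rule M_edge)
    then have "e \<inter> A = {x}" "e \<inter> B = {y}" using A_B by auto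
    then show "card (e \<inter> A) = 1" "card (e \<inter> B) = 1" by simp_all
  qed
  have le: "degree M v \<le> 2 * degree (M - H) v" if "v \<in> A" for v
    using degree_M_A[OF that] degree_A[OF that] that unfolding A_def low_def by auto
  have "card M = (\<Sum>v\<in>A. degree M v)"
    using sum_degree_eq_card[of M A] finite_M fin one by simp
  also have "\<dots> < (\<Sum>v\<in>A. 2 * degree (M - H) v)"
  proof (rule sum_strict_mono_ex1)
    show "\<exists>v\<in>A. degree M v < 2 * degree (M - H) v"
      using degree_M_A[OF A_B(4)] degree_A[OF A_B(4)] root A_B by (intro bexI[of _ r]) auto
  qed (use fin le in auto)
  also have "\<dots> = 2 * card (M - H)"
    using sum_degree_eq_card[of "M - H" A] finite_M fin one by (simp flip: sum_distrib_left)
  finally have less: "card M < 2 * card (M - H)" .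
  have "card M = (\<Sum>v\<in>B. degree M v)"
    using sum_degree_eq_card[of M B] finite_M fin one by simp
  also have "\<dots> \<le> (\<Sum>v\<in>B. 2 * degree (M \<inter> H) v)"
    by (rule sum_mono) (simp add: degree_B degree_M_B)
  also have "\<dots> = 2 * card (M \<inter> H)"
    using sum_degree_eq_card[of "M \<inter> H" B] finite_M fin one by (simp flip: sum_distrib_left)
  finally have "card M \<le> 2 * card (M \<inter> H)" .
  moreover have "card M = card (M - H) + card (M \<inter> H)"
    using card_Int_Diff[OF finite_M, of H] by simp
  ultimately show False using less by simp
qed

end

text \<open>Subgraph and targets are optimised jointly; zero deficit and the cap leave only degrees
  \<open>b v\<close> and \<open>b v + 1\<close>.\<close>

theorem degree_constrained_subgraph:
  assumes "simple_graph V E"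
    and "\<And>v. v \<in> V \<Longrightarrow> 2 * l v \<le> degree E v"
    and "\<And>v. v \<in> V \<Longrightarrow> degree E v \<le> 2 * u v + 2"
    and "\<And>v. v \<in> V \<Longrightarrow> 2 * u v \<le> degree E v + l v + 2"
    and "\<And>v. v \<in> V \<Longrightarrow> u v \<le> 2 * l v + 3"
  shows "\<exists>F\<subseteq>E. \<forall>v\<in>V. degree F v \<in> {l v, l v + 1, u v, u v + 1}"
proof -
  define P where "P = (\<lambda>(F, b). F \<subseteq> E \<and> (\<forall>v\<in>V. b v \<in> {l v, u v}) \<and>
    (\<forall>v\<in>V. degree F v \<le> b v + 1))"
  define D where "D = (\<lambda>(F, b). \<Sum>v\<in>V. b v - degree F v)"
  have "P ({}, l)" unfolding P_def degree_def by simp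
  then obtain p where p: "P p" "\<And>q. P q \<Longrightarrow> D p \<le> D q"
    using ex_has_least_nat[of P _ D] by blast
  obtain H a where p_eq: "p = (H, a)" by (cases p)
  have "a v \<le> degree H v" if "v \<in> V" for v
  proof (rule ccontr)
    assume "\<not> ?thesis"
    then have "least_deficit V E H l u a v"
      using p(1) p(2)[of "(_, _)"] that assms unfolding p_eq P_def D_def
      by unfold_locales auto
    then show False by (rule least_deficit.contradiction)
  qed
  then have "degree H v \<in> {l v, l v + 1, u v, u v + 1}" if "v \<in> V" for v
    using p(1) that unfolding p_eq P_def by force
  moreover have "H \<subseteq> E" using p(1) unfolding p_eq P_def by simp
  ultimately show ?thesis by blast
qed

section \<open>Degree multiplicities\<close>

lemma max_mult_le:
  assumes "finite V" "\<And>k. mult_deg V F k \<le> m"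
  shows "max_mult V F \<le> m"
proof -
  have "range (mult_deg V F) \<subseteq> {..m}" using assms(2) by auto
  then have "finite (range (mult_deg V F))" by (rule finite_subset) simp
  then show ?thesis unfolding max_mult_def using assms(2) by simp
qed

text \<open>Number the vertices and colour by residue modulo \<open>K\<close>; within a colour the
  quotients differ.\<close>

lemma equitable_colouring:
  fixes K :: nat
  assumes "finite V" "K > 0"
  obtains c where "\<And>v. v \<in> V \<Longrightarrow> c v < K" "\<And>i. card {v \<in> V. c v = i} \<le> card V div K + 1"
proof -
  obtain f where f: "bij_betw f V {0..<card V}"
    using ex_bij_betw_finite_nat[OF assms(1)] by blast
  have "card {v \<in> V. f v mod K = i} \<le> card {..card V div K}" for i
  proof (rule card_inj_on_le)
    show "inj_on (\<lambda>v. f v div K) {v \<in> V. f v mod K = i}"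
    proof (rule inj_onI)
      fix v w
      assume vw: "v \<in> {v \<in> V. f v mod K = i}" "w \<in> {v \<in> V. f v mod K = i}" "f v div K = f w div K"
      then have "f v = f w"
        using div_mult_mod_eq[of "f v" K] div_mult_mod_eq[of "f w" K] by simp
      with vw show "v = w" using inj_onD[OF bij_betw_imp_inj_on[OF f]] by simp
    qed
    have "f v div K \<le> card V div K" if "v \<in> V" for v
      using bij_betwE[OF f] that by (intro div_le_mono) (simp add: less_imp_le)
    then show "(\<lambda>v. f v div K) ` {v \<in> V. f v mod K = i} \<subseteq> {..card V div K}" by auto
  qed simp
  then show thesis
    using that[of "\<lambda>v. f v mod K"] assms(2) by simp
qed

theorem theorem1p5:
  fixes V :: "'a set" and E :: "'a set set" and d :: nat
  assumes "d \<ge> 1"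
    and "simple_graph V E"
    and "regular V E d"
  shows "\<exists>F. spanning_subgraph V E F \<and>
           real (max_mult V F) \<le> 8 * real (card V) / real d + 2"
proof (cases "d = 1")
  \<comment> \<open>The bound exceeds \<open>card V\<close>; the choice of \<open>s\<close> below
    would have to be -1.\<close>
  case True
  have "finite V" using assms(2) unfolding simple_graph_def by simp
  then have "max_mult V {} \<le> card V"
    by (intro max_mult_le) (auto simp: mult_deg_def intro: card_mono)
  with True show ?thesis
    by (intro exI[of _ "{}"]) (simp add: spanning_subgraph_def)
next
  case False
  then have d: "d \<ge> 2" using assms(1) by simp
  have fin: "finite V" using assms(2) unfolding simple_graph_def by simp
  have reg: "\<And>v. v \<in> V \<Longrightarrow> degree E v = d" using assms(3) unfolding regular_def by simp
  define K where "K = (d + 7) div 8"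
  define h where "h = d div 2"
  have half: "2 * h \<le> d" "d \<le> 2 * h + 1" unfolding h_def by simp_all
  define s where "s = h + 1 - 2 * K"
  have K: "d \<le> 8 * K" "8 * K \<le> d + 7" "K > 0" using d unfolding K_def by auto
  have s: "s + 2 * K = h + 1" unfolding s_def using d K(2) half by linarith
  obtain c where c: "\<And>v. v \<in> V \<Longrightarrow> c v < K"
    "\<And>i. card {v \<in> V. c v = i} \<le> card V div K + 1"
    using equitable_colouring[OF fin K(3)] by blast
  \<comment> \<open>The degree sets of the \<open>K\<close> colours partition the interval from
    \<open>s\<close> to \<open>s + 4 * K - 1\<close>, whose halves meet between \<open>h\<close> and
    \<open>h + 1\<close>. \<open>8 * K \<le> d + 7\<close> is what
    \<open>2 * u v \<le> d + l v + 2\<close> needs at \<open>c v = K - 1\<close> and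
    \<open>u v \<le> 2 * l v + 3\<close> at \<open>c v = 0\<close>.\<close>
  define l where "l v = s + 2 * c v" for v
  define u where "u v = s + 2 * K + 2 * c v" for v
  have "\<exists>F\<subseteq>E. \<forall>v\<in>V. degree F v \<in> {l v, l v + 1, u v, u v + 1}"
  proof (rule degree_constrained_subgraph[OF assms(2)])
    fix v assume "v \<in> V"
    then have "c v + 1 \<le> K" using c(1)[of v] by simp
    note facts = reg[OF \<open>v \<in> V\<close>] this l_def[of v] u_def[of v] s half K
    show "2 * l v \<le> degree E v" using facts by linarith
    show "degree E v \<le> 2 * u v + 2" using facts by linarith
    show "2 * u v \<le> degree E v + l v + 2" using facts by linarith
    show "u v \<le> 2 * l v + 3" using facts by linarith
  qed
  then obtain F where F: "F \<subseteq> E"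
    "\<And>v. v \<in> V \<Longrightarrow> degree F v \<in> {l v, l v + 1, u v, u v + 1}" by blast
  have "mult_deg V F k \<le> card V div K + 1" for k
  proof -
    \<comment> \<open>The degree determines the colour, so vertices of equal degree share a colour
      class.\<close>
    have "c v = ((k - s) div 2) mod K" if "v \<in> V" "degree F v = k" for v
    proof -
      have "(k - s) div 2 \<in> {c v, K + c v}" using F(2)[OF that(1)]
        unfolding that(2) l_def u_def by auto
      then show ?thesis using c(1)[OF that(1)] by auto
    qed
    then have "mult_deg V F k \<le> card {v \<in> V. c v = ((k - s) div 2) mod K}"
      unfolding mult_deg_def using fin by (intro card_mono) auto
    also have "\<dots> \<le> card V div K + 1" by (rule c(2))
    finally show ?thesis .
  qed
  then have "real (max_mult V F) \<le> real (card V div K + 1)"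
    by (intro of_nat_mono max_mult_le[OF fin])
  also have "\<dots> \<le> real (card V) / real K + 1"
    using of_nat_div_le_of_nat[of "card V" K, where ?'a = real] by simp
  also have "real (card V) / real K \<le> 8 * real (card V) / real d"
  proof -
    have "real (card V) * real d \<le> real (card V) * (8 * real K)"
      using K(1) by (intro mult_left_mono) auto
    then show ?thesis using K(3) d by (simp add: field_simps)
  qed
  finally show ?thesis
    using F(1) by (intro exI[of _ F]) (simp add: spanning_subgraph_def)
qed

end
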